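(* Let $\mathcal V$ be a Euclidean Jordan algebra of rank $n\ge2$. For $x\in\mathcal V_+$ let $\kappa_{\|\cdot\|}(x):=\|\kappa(x)\|$, where $\kappa(x)=\left(\lambda_i(x)/\lambda_{n-i+1}(x)\right)_{i=1}^{\lfloor n/2\rfloor}\in\mathbb R^{\lfloor n/2\rfloor}$. Then: (a) $\kappa_{\|\cdot\|}:\mathcal V_+\to\mathbb R$ is a spectral function with associated symmetric function $\phi_{\|\cdot\|}:\mathbb R^n_+\to\mathbb R$ given by $\phi_{\|\cdot\|}(u)=\|\phi(u)\|$, with $$\phi(u)=\left(\frac{u^\downarrow_1}{u^\downarrow_n},\frac{u^\downarrow_2}{u^\downarrow_{n-1}},\dots,\frac{u^\downarrow_{\lfloor n/2\rfloor}}{u^\downarrow_{n-\lfloor n/2\rfloor+1}}\right)\in\mathbb R^{\lfloor n/2\rfloor}.$$ (b) $\kappa_{\|\cdot\|}$ is a strictly Schur-convex spectral function on $\mathcal V_+$.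
   Context: A Euclidean Jordan algebra (EJA) $\mathcal V$ is a finite-dimensional real inner product space with a commutative bilinear product $\circ$ satisfying the Jordan identity $(x\circ y)\circ(x\circ x)=x\circ(y\circ(x\circ x))$, having a unit $e$, and with $\langle x\circ y,z\rangle=\langle y,x\circ z\rangle$. A primitive idempotent is a nonzero $c$ with $c\circ c=c$ that is not a sum of two nonzero idempotents. A Jordan frame is a collection $\{e_1,\dots,e_n\}$ of primitive idempotents with $\sum_i e_i=e$ and $e_i\circ e_j=0$ for $i\ne j$; $n$ is the rank of $\mathcal V$. Every $x\in\mathcal V$ has a spectral decomposition $x=\sum_{i=1}^n\lambda_i(x)e_i$ for some Jordan frame, where $\lambda_1(x)\ge\dots\ge\lambda_n(x)$ are the (uniquely determined) eigenvalues of $x$; $\lambda(x)=(\lambda_1(x),\dots,\lambda_n(x))\in\mathbb R^n$. $\mathcal V_+=\{x\in\mathcal V:\lambda_n(x)>0\}$; $\mathbb R^n_+$ is the set of vectors in $\mathbb R^n$ with all entries strictly positive; $\|\cdot\|$ is the Euclidean norm on $\mathbb R^{\lfloor n/2\rfloor}$; $u^\downarrow$ is the nonincreasing rearrangement of $u\in\mathbb R^n$. A function $F:\mathcal V_+\to\mathbb R$ is a spectral function with associated symmetric function $f:\mathbb R^n_+\to\mathbb R$ if $f$ is permutation invariant and $F(x)=f(\lambda(x))$ for all $x\in\mathcal V_+$. One writes $u\prec v$ if $\sum_{i=1}^k u_i^\downarrow\le\sum_{i=1}^k v_i^\downarrow$ for $k=1,\dots,n$, with equality for $k=n$. $f$ is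 strictly Schur-convex on $\mathbb R^n_+$ if for all $u,v\in\mathbb R^n_+$, $u\prec v$ implies $f(u)\le f(v)$, and $f(u)<f(v)$ whenever $u\prec v$ and $u^\downarrow\neq v^\downarrow$. The spectral function $F$ is strictly Schur-convex on $\mathcal V_+$ if its associated symmetric function $f$ is strictly Schur-convex on $\mathbb R^n_+$. *)

theory Defs
  imports "HOL-Analysis.Analysis" "HOL-Combinatorics.Permutations"
begin

section \<open>Euclidean Jordan algebras\<close>

text \<open>The underlying finite-dimensional real inner product space is a type of class
  \<^class>\<open>euclidean_space\<close>, with inner product \<open>x \<bullet> y\<close>; \<open>p\<close> is the Jordan product and \<open>e\<close> the unit.\<close>

locale euclidean_jordan_algebra =
  fixes p :: "'a::euclidean_space \<Rightarrow> 'a \<Rightarrow> 'a" and e :: 'a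
  assumes bilinear: "bilinear p"
    and commute: "p x y = p y x"
    and jordan_identity: "p (p x y) (p x x) = p x (p y (p x x))"
    and unit: "p e x = x"
    and inner_assoc: "p x y \<bullet> z = y \<bullet> p x z"

definition idempotent :: "('a::euclidean_space \<Rightarrow> 'a \<Rightarrow> 'a) \<Rightarrow> 'a \<Rightarrow> bool" where
  "idempotent p c \<longleftrightarrow> p c c = c"

definition primitive_idempotent :: "('a::euclidean_space \<Rightarrow> 'a \<Rightarrow> 'a) \<Rightarrow> 'a \<Rightarrow> bool" where
  "primitive_idempotent p c \<longleftrightarrow> idempotent p c \<and> c \<noteq> 0 \<and>
     \<not> (\<exists>a b. idempotent p a \<and> a \<noteq> 0 \<and> idempotent p b \<and> b \<noteq> 0 \<and> c = a + b)"

text \<open>Frames are lists, so that they can be paired with lists of eigenvalues. The members of a frame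
  are automatically distinct, since \<open>p c c = c \<noteq> 0\<close> for each of them.\<close>

definition jordan_frame :: "('a::euclidean_space \<Rightarrow> 'a \<Rightarrow> 'a) \<Rightarrow> 'a \<Rightarrow> 'a list \<Rightarrow> bool" where
  "jordan_frame p e es \<longleftrightarrow>
     (\<forall>c\<in>set es. primitive_idempotent p c) \<and>
     sum_list es = e \<and>
     (\<forall>i<length es. \<forall>j<length es. i \<noteq> j \<longrightarrow> p (es ! i) (es ! j) = 0)"

text \<open>All Jordan frames of a Euclidean Jordan algebra have the same number of elements.\<close>

definition jordan_rank :: "('a::euclidean_space \<Rightarrow> 'a \<Rightarrow> 'a) \<Rightarrow> 'a \<Rightarrow> nat" where
  "jordan_rank p e = (THE n. \<exists>es. jordan_frame p e es \<and> length es = n)"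

text \<open>The vector \<open>\<lambda>(x)\<close>, as the unique nonincreasing list of coefficients of \<open>x\<close> with respect to some
  Jordan frame. Lists are indexed from 0: \<open>\<lambda>\<^sub>i(x)\<close> is \<open>eigenvalues p e x ! (i - 1)\<close>.\<close>

definition eigenvalues :: "('a::euclidean_space \<Rightarrow> 'a \<Rightarrow> 'a) \<Rightarrow> 'a \<Rightarrow> 'a \<Rightarrow> real list" where
  "eigenvalues p e x = (THE l. sorted_wrt (\<ge>) l \<and>
     (\<exists>es. jordan_frame p e es \<and> length es = length l \<and>
           x = (\<Sum>i<length es. (l ! i) *\<^sub>R (es ! i))))"

definition positive_cone :: "('a::euclidean_space \<Rightarrow> 'a \<Rightarrow> 'a) \<Rightarrow> 'a \<Rightarrow> 'a set" where
  "positive_cone p e = {x. eigenvalues p e x ! (jordan_rank p e - 1) > 0}"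

section \<open>Symmetric functions and majorization on real n-space\<close>

text \<open>Vectors of length \<open>n\<close> are real lists of length \<open>n\<close>, because \<open>n\<close> is the rank of an algebra.\<close>

definition pos_vectors :: "nat \<Rightarrow> real list set" where
  "pos_vectors n = {u. length u = n \<and> (\<forall>t\<in>set u. t > 0)}"

definition decreasing :: "real list \<Rightarrow> real list" where
  "decreasing u = rev (sort u)"

definition euclidean_norm :: "real list \<Rightarrow> real" where
  "euclidean_norm u = L2_set (\<lambda>i. u ! i) {..<length u}"

definition majorized :: "nat \<Rightarrow> real list \<Rightarrow> real list \<Rightarrow> bool" where
  "majorized n u v \<longleftrightarrow>
     (\<forall>k\<in>{1..n}. (\<Sum>i<k. decreasing u ! i) \<le> (\<Sum>i<k. decreasing v ! i)) \<and>
     (\<Sum>i<n. decreasing u ! i) = (\<Sum>i<n. decreasing v ! i)"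

definition permutation_invariant :: "nat \<Rightarrow> (real list \<Rightarrow> real) \<Rightarrow> bool" where
  "permutation_invariant n f \<longleftrightarrow>
     (\<forall>u\<in>pos_vectors n. \<forall>\<pi>. \<pi> permutes {..<n} \<longrightarrow> f (permute_list \<pi> u) = f u)"

definition strictly_schur_convex :: "nat \<Rightarrow> (real list \<Rightarrow> real) \<Rightarrow> bool" where
  "strictly_schur_convex n f \<longleftrightarrow>
     (\<forall>u\<in>pos_vectors n. \<forall>v\<in>pos_vectors n. majorized n u v \<longrightarrow>
        f u \<le> f v \<and> (decreasing u \<noteq> decreasing v \<longrightarrow> f u < f v))"

section \<open>Spectral functions\<close>

text \<open>Functions on the positive cone are total functions of which only the values on
  \<^const>\<open>positive_cone\<close> matter; likewise for functions on \<^const>\<open>pos_vectors\<close>.\<close>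

definition spectral_function ::
  "('a::euclidean_space \<Rightarrow> 'a \<Rightarrow> 'a) \<Rightarrow> 'a \<Rightarrow> ('a \<Rightarrow> real) \<Rightarrow> (real list \<Rightarrow> real) \<Rightarrow> bool" where
  "spectral_function p e F f \<longleftrightarrow>
     permutation_invariant (jordan_rank p e) f \<and>
     (\<forall>x\<in>positive_cone p e. eigenvalues p e x \<in> pos_vectors (jordan_rank p e) \<and>
                              F x = f (eigenvalues p e x))"

text \<open>The associated symmetric function of \<open>F\<close> is determined by \<open>F\<close> on \<^const>\<open>pos_vectors\<close>, so
  the existential quantifier refers to a unique object.\<close>

definition strictly_schur_convex_spectral ::
  "('a::euclidean_space \<Rightarrow> 'a \<Rightarrow> 'a) \<Rightarrow> 'a \<Rightarrow> ('a \<Rightarrow> real) \<Rightarrow> bool" where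
  "strictly_schur_convex_spectral p e F \<longleftrightarrow>
     (\<exists>f. spectral_function p e F f \<and> strictly_schur_convex (jordan_rank p e) f)"

section \<open>The condition-number functions\<close>

text \<open>The entry with 0-based index \<open>i\<close> is the quotient of the \<open>(i+1)\<close>-th entry by the \<open>(n-i)\<close>-th entry,
  the latter having 0-based index \<open>n - 1 - i\<close>.\<close>

definition kappa :: "('a::euclidean_space \<Rightarrow> 'a \<Rightarrow> 'a) \<Rightarrow> 'a \<Rightarrow> 'a \<Rightarrow> real list" where
  "kappa p e x = (let n = jordan_rank p e in
     map (\<lambda>i. eigenvalues p e x ! i / eigenvalues p e x ! (n - 1 - i)) [0..<n div 2])"

definition kappa_norm :: "('a::euclidean_space \<Rightarrow> 'a \<Rightarrow> 'a) \<Rightarrow> 'a \<Rightarrow> 'a \<Rightarrow> real" where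
  "kappa_norm p e x = euclidean_norm (kappa p e x)"

definition phi :: "nat \<Rightarrow> real list \<Rightarrow> real list" where
  "phi n u = map (\<lambda>i. decreasing u ! i / decreasing u ! (n - 1 - i)) [0..<n div 2]"

definition phi_norm :: "nat \<Rightarrow> real list \<Rightarrow> real" where
  "phi_norm n u = euclidean_norm (phi n u)"

end

theory Submission
  imports Defs
begin

text \<open>A maximal orthogonal set of idempotent eigenvectors of \<open>x\<close> is a Jordan frame that diagonalizes
  \<open>x\<close>, and two such frames are related by a doubly stochastic matrix that only links equal
  eigenvalues, so that \<open>\<lambda>(x)\<close> is well defined. For strict Schur convexity, the tangent line bounds
  of \<open>(a, b) \<mapsto> (a / b)\<^sup>2\<close> in one variable at a time have monotone slopes; summation by parts
  against the partial sums of \<open>v\<down> - u\<down>\<close> makes the linear terms nonnegative, and the quadratic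
  remainders are positive unless the two vectors agree.\<close>

section \<open>Idempotents in Euclidean Jordan algebras\<close>

context euclidean_jordan_algebra
begin

section \<open>Bilinearity and definiteness of the Jordan product\<close>

lemma
  shows p_add_left: "p (x + y) z = p x z + p y z"
    and p_add_right: "p x (y + z) = p x y + p x z"
    and p_diff_left: "p (x - y) z = p x z - p y z"
    and p_diff_right: "p x (y - z) = p x y - p x z"
    and p_scaleR_left: "p (t *\<^sub>R x) z = t *\<^sub>R p x z"
    and p_scaleR_right: "p x (t *\<^sub>R z) = t *\<^sub>R p x z"
    and p_zero_left [simp]: "p 0 z = 0"
    and p_zero_right [simp]: "p z 0 = 0"
  using bilinear
  by (simp_all add: bilinear_ladd bilinear_radd bilinear_lsub bilinear_rsub bilinear_lmul
      bilinear_rmul bilinear_lzero bilinear_rzero)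

lemmas p_simps = p_add_left p_add_right p_diff_left p_diff_right p_scaleR_left p_scaleR_right

lemma linear_p: "linear (p x)"
  by (intro linearI) (simp_all add: p_simps)

lemma p_sum_right: "p x (\<Sum>i\<in>I. f i) = (\<Sum>i\<in>I. p x (f i))"
  using linear_sum[OF linear_p] .

lemma unit_right [simp]: "p x e = x"
  by (metis commute unit)

lemma inner_p_self: "p x x \<bullet> e = x \<bullet> x"
  by (simp add: inner_assoc)

lemma p_self_eq_0_iff: "p x x = 0 \<longleftrightarrow> x = 0"
  by (metis inner_eq_zero_iff inner_p_self inner_zero_left p_zero_left)

text \<open>Polarization: the Jordan identity is cubic in \<open>x\<close>, so subtracting its
  instance at \<open>a - b\<close> from that at \<open>a + b\<close> leaves twice the part linear in
  \<open>b\<close> plus twice the instance at \<open>b\<close>. Pairing with \<open>z\<close> turns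
  this into an equation of real numbers.\<close>

lemma jordan_linearized2:
  "p (p b d) (p a a) + 2 *\<^sub>R p (p a d) (p a b) = p b (p d (p a a)) + 2 *\<^sub>R p a (p d (p a b))"
proof (rule vector_eq_rdot[THEN iffD1], rule allI)
  fix z
  have J: "p (p x d) (p x x) \<bullet> z = p x (p d (p x x)) \<bullet> z" for x
    by (simp add: jordan_identity)
  show "(p (p b d) (p a a) + 2 *\<^sub>R p (p a d) (p a b)) \<bullet> z
      = (p b (p d (p a a)) + 2 *\<^sub>R p a (p d (p a b))) \<bullet> z"
    using J[of "a + b"] J[of "a - b"] J[of b]
    by (simp add: p_simps inner_simps commute[of b a])
qed

text \<open>A second polarization, \<open>a\<close> being replaced by \<open>a + c\<close>, makes
  the identity linear in each variable.\<close>

lemma jordan_linearized: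
  "p (p a d) (p b c) + p (p b d) (p c a) + p (p c d) (p a b)
   = p a (p d (p b c)) + p b (p d (p c a)) + p c (p d (p a b))"
proof (rule vector_eq_rdot[THEN iffD1], rule allI)
  fix z
  have J: "(p (p b d) (p x x) + 2 *\<^sub>R p (p x d) (p x b)) \<bullet> z
      = (p b (p d (p x x)) + 2 *\<^sub>R p x (p d (p x b))) \<bullet> z" for x
    by (simp add: jordan_linearized2)
  show "(p (p a d) (p b c) + p (p b d) (p c a) + p (p c d) (p a b)) \<bullet> z
      = (p a (p d (p b c)) + p b (p d (p c a)) + p c (p d (p a b))) \<bullet> z"
    using J[of "a + c"] J[of a] J[of c]
    by (simp add: p_simps inner_simps commute[of c a] commute[of b a] commute[of c b])
qed

text \<open>To be read as an identity of operators acting on \<open>a\<close>: multiplication by a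
  triple product is a polynomial in the multiplications by its factors and by their pairwise
  products.\<close>

lemma p_triple:
  "p (p (p b c) d) a = p (p b c) (p d a) + p (p b d) (p c a) + p (p c d) (p b a)
     - p b (p d (p c a)) - p c (p d (p b a))"
  using jordan_linearized[of a d b c]
  by (simp add: algebra_simps commute[of a d] commute[of a b] commute[of d "p b c"] commute[of a "p d (p b c)"]
    commute[of "p d a" "p b c"] commute[of a "p (p b c) d"])

section \<open>The spectrum of multiplication by an idempotent\<close>

lemma scaleR_3: "3 *\<^sub>R x = x + x + x" for x :: 'a
  using scaleR_add_left[of 1 2 x] by (simp add: scaleR_2)

text \<open>With all three factors equal to \<open>c\<close>, \<open>p_triple\<close> says that L =
  \<open>p c\<close> satisfies L (L - 1) (2 L - 1) = 0.\<close>

lemma idempotent_cubic: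
  assumes "idempotent p c"
  shows "p c d = 3 *\<^sub>R p c (p c d) - 2 *\<^sub>R p c (p c (p c d))"
  using p_triple[of c c c d] assms
  by (simp add: idempotent_def scaleR_3 scaleR_2 algebra_simps)

text \<open>The eigenvalues of multiplication by an idempotent are 0, 1/2 and 1, and
  \<open>t = t\<^sup>2 + 4 (t - t\<^sup>2)\<^sup>2\<close> holds at these three points.\<close>

lemma inner_idempotent_eq:
  assumes "idempotent p c"
  shows "p c d \<bullet> d = p c d \<bullet> p c d + 4 * ((p c d - p c (p c d)) \<bullet> (p c d - p c (p c d)))"
proof -
  define a where "a = p c d"
  define b where "b = p c a"
  have a: "a = 3 *\<^sub>R b - 2 *\<^sub>R p c b"
    using idempotent_cubic[OF assms] unfolding a_def b_def .
  have b: "b = 3 *\<^sub>R p c b - 2 *\<^sub>R p c (p c b)"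
    using idempotent_cubic[OF assms] unfolding b_def .
  have ad: "a \<bullet> d = 3 * (a \<bullet> a) - 2 * (a \<bullet> b)"
  proof -
    have "b \<bullet> d = a \<bullet> a" by (simp add: b_def a_def inner_assoc inner_commute)
    moreover have "p c b \<bullet> d = a \<bullet> b" unfolding a_def by (simp add: inner_assoc[of c b d] inner_commute[of b])
    ultimately show ?thesis by (subst (1) a) (simp add: inner_simps)
  qed
  have "p c b \<bullet> a = b \<bullet> b" by (simp add: inner_assoc b_def)
  then have "a \<bullet> a = 3 * (a \<bullet> b) - 2 * (b \<bullet> b)"
    by (subst (1) a) (simp add: inner_simps inner_commute)
  then show ?thesis
    using ad unfolding a_def[symmetric] b_def[symmetric]
    by (simp add: inner_simps inner_commute)
qed

lemma inner_idempotents: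
  assumes "idempotent p d"
  shows "p c d \<bullet> d = c \<bullet> d"
  by (metis assms commute idempotent_def inner_assoc)

text \<open>The inner product equals \<open>p c d \<bullet> d\<close>, which
  \<open>inner_idempotent_eq\<close> presents as a sum of squared norms.\<close>

lemma inner_idempotents_nonneg:
  assumes "idempotent p c" "idempotent p d"
  shows "c \<bullet> d \<ge> 0"
  using inner_idempotent_eq[OF assms(1), of d] inner_idempotents[OF assms(2), of c]
  by (smt (verit) inner_ge_zero)

text \<open>The squared norm of \<open>p c d\<close> is one of the summands in
  \<open>inner_idempotent_eq\<close>, so it vanishes with the sum.\<close>

lemma orthogonal_idempotents:
  assumes "idempotent p c" "idempotent p d"
  shows "c \<bullet> d = 0 \<longleftrightarrow> p c d = 0"
proof
  assume "c \<bullet> d = 0"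
  then have "p c d \<bullet> p c d = 0"
    using inner_idempotent_eq[OF assms(1), of d] inner_idempotents[OF assms(2), of c]
    by (smt (verit) inner_ge_zero)
  then show "p c d = 0" by simp
qed (use inner_idempotents[OF assms(2), of c] in simp)

lemma idempotent_summands:
  assumes "idempotent p a" "idempotent p b" "idempotent p (a + b)"
  shows "p a b = 0"
proof -
  have "2 *\<^sub>R p a b = 0"
    using assms by (simp add: idempotent_def p_simps commute[of b a] scaleR_2 algebra_simps)
  then show ?thesis by simp
qed

lemma idempotent_diff:
  assumes "idempotent p c" "idempotent p d" "p c d = d"
  shows "idempotent p (c - d)"
  using assms by (simp add: idempotent_def p_simps commute[of d c])

end

text \<open>A maximizer of the Rayleigh quotient on the unit sphere of \<open>A\<close> works: the
  first-order condition is the eigenvalue equation.\<close>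

lemma symmetric_eigenvector:
  fixes T :: "'a::euclidean_space \<Rightarrow> 'a"
  assumes "linear T" and sym: "\<And>x y. T x \<bullet> y = x \<bullet> T y"
    and A: "subspace A" "T ` A \<subseteq> A" "a \<in> A" "a \<noteq> 0"
  obtains v \<mu> where "v \<in> A" "v \<noteq> 0" "T v = \<mu> *\<^sub>R v"
proof -
  define S where "S = A \<inter> sphere 0 1"
  have cS: "compact S"
    unfolding S_def by (intro closed_Int_compact closed_subspace A compact_sphere)
  have "(1 / norm a) *\<^sub>R a \<in> S"
    using A by (simp add: S_def subspace_scale)
  then have "S \<noteq> {}" by blast
  moreover have "continuous_on S (\<lambda>x. T x \<bullet> x)"
    by (intro continuous_intros linear_continuous_on linear_conv_bounded_linear[THEN iffD1] assms)
  ultimately obtain v where v: "v \<in> S" and max: "\<And>x. x \<in> S \<Longrightarrow> T x \<bullet> x \<le> T v \<bullet> v"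
    using continuous_attains_sup[OF cS, of "\<lambda>x. T x \<bullet> x"] by blast
  define \<mu> where "\<mu> = T v \<bullet> v"
  have vA: "v \<in> A" and v1: "v \<bullet> v = 1"
    using v by (auto simp: S_def norm_eq_1)
  have le: "T x \<bullet> x \<le> \<mu> * (x \<bullet> x)" if "x \<in> A" for x
  proof (cases "x = 0")
    case False
    then have "(1 / norm x) *\<^sub>R x \<in> S"
      using A that by (simp add: S_def subspace_scale)
    then have "(T x \<bullet> x) / (norm x)\<^sup>2 \<le> \<mu>"
      using max[of "(1 / norm x) *\<^sub>R x"] linear_scale[OF assms(1)]
      by (simp add: \<mu>_def power2_eq_square)
    then show ?thesis
      using False by (simp add: divide_le_eq power2_norm_eq_inner)
  qed (use linear_0[OF assms(1)] in simp)
  define w where "w = T v - \<mu> *\<^sub>R v"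
  have wA: "w \<in> A"
    unfolding w_def using A vA by (intro subspace_diff subspace_scale) auto
  \<comment> \<open>The coefficient of \<open>t\<^sup>2\<close> when \<open>le\<close> is expanded
    at \<open>v + t *\<^sub>R w\<close>. The linear term is \<open>2 * t * (w \<bullet> w)\<close>,
    so small \<open>t\<close> force \<open>w\<close> to vanish.\<close>
  define C where "C = \<mu> * (w \<bullet> w) - T w \<bullet> w"
  have quad: "2 * t * (w \<bullet> w) \<le> t\<^sup>2 * C" for t
  proof -
    have "v + t *\<^sub>R w \<in> A" using A vA wA by (intro subspace_add subspace_scale)
    from le[OF this] have "2 * t * (T v \<bullet> w - \<mu> * (v \<bullet> w)) \<le> t\<^sup>2 * C"
      using sym[of w v] v1
      by (simp add: linear_add[OF assms(1)] linear_scale[OF assms(1)] inner_simps C_def \<mu>_def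
          power2_eq_square inner_commute algebra_simps)
    moreover have "T v \<bullet> w - \<mu> * (v \<bullet> w) = w \<bullet> w"
      by (simp add: w_def inner_simps inner_commute algebra_simps)
    ultimately show ?thesis by simp
  qed
  have "w \<bullet> w = 0"
  proof (rule ccontr)
    assume "w \<bullet> w \<noteq> 0"
    then have pos: "w \<bullet> w > 0" by simp
    \<comment> \<open>Small enough that \<open>t * C\<close> is at most
      \<open>w \<bullet> w\<close>, whereas \<open>quad\<close> demands at least twice that.\<close>
    define t where "t = w \<bullet> w / (\<bar>C\<bar> + 1)"
    have t: "t > 0" using pos by (simp add: t_def)
    have "2 * (w \<bullet> w) \<le> t * C"
      using quad[of t] t by (simp add: power2_eq_square)
    also have "\<dots> \<le> t * (\<bar>C\<bar> + 1)" using t by (intro mult_left_mono) auto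
    also have "\<dots> = w \<bullet> w" by (simp add: t_def add_nonneg_eq_0_iff)
    finally show False using pos by simp
  qed
  then have "T v = \<mu> *\<^sub>R v" by (simp add: w_def)
  moreover have "v \<noteq> 0" using v1 by auto
  ultimately show thesis using that vA by blast
qed

context euclidean_jordan_algebra
begin

text \<open>The operators of multiplication by elements of the span of the
  powers of \<open>y\<close> commute with multiplication by \<open>y\<close>, so that an eigenvector of the latter in this span
  is an eigenvector of all of them, in particular of the multiplication by itself.\<close>

lemma idempotent_eigenvector:
  assumes u: "idempotent p u" "u \<noteq> 0" and uy: "p u y = y"
  obtains d \<mu> where "idempotent p d" "d \<noteq> 0" "p u d = d" "p y d = \<mu> *\<^sub>R d"
proof -
  \<comment> \<open>The powers start at \<open>u\<close> instead of \<open>e\<close>: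
    \<open>u\<close> acts as the unit on their span, which keeps the idempotent to be found below
    \<open>u\<close>.\<close>
  define pw where "pw n = (p y ^^ n) u" for n
  have pw_0: "pw 0 = u" and pw_Suc: "pw (Suc n) = p y (pw n)" for n
    by (simp_all add: pw_def)
  \<comment> \<open>As \<open>p u y = y\<close>, the linearized identity at u, u, y collapses to 2
    y(uz) + u(yz) = 2 u(yz) + y(uz).\<close>
  have u_comm: "p u (p y z) = p y (p u z)" for z
    using jordan_linearized[of u z u y] u uy
    by (simp add: idempotent_def commute[of y u] commute[of "p u z"] commute[of "p y z"] commute[of z])
  \<comment> \<open>Two consecutive powers are treated at once, because \<open>p_triple\<close>
    expresses multiplication by a power through those by the two preceding powers, by
    \<open>y\<close> and by \<open>p y y\<close>.\<close>
  have pw_comm: "p (pw n) (p y z) = p y (p (pw n) z) \<and>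
      p (pw (Suc n)) (p y z) = p y (p (pw (Suc n)) z)" for n z
  proof (induction n arbitrary: z)
    case 0
    then show ?case
      by (simp add: pw_0 pw_Suc u_comm commute[of y u] uy)
  next
    case (Suc n)
    have yy: "p (p y y) (p y z) = p y (p (p y y) z)" for z
      using jordan_identity[of y z] by (simp add: commute)
    have "p (pw (Suc (Suc n))) z = p (pw (Suc n)) (p y z) + p (p y y) (p (pw n) z)
        + p (pw (Suc n)) (p y z) - p y (p y (p (pw n) z)) - p (pw n) (p y (p y z))" for z
      using p_triple[of y "pw n" y z] unfolding pw_Suc commute[of "p y (pw n)" y] commute[of "pw n" y] .
    then show ?case
      using Suc yy by (simp add: p_simps)
  qed
  have u_pw: "p u (pw n) = pw n" for n
    by (induction n) (use u in \<open>simp_all add: pw_0 pw_Suc u_comm idempotent_def\<close>)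
  define A where "A = span (range pw)"
  have A: "subspace A" unfolding A_def by simp
  have uA: "p u z = z" if "z \<in> A" for z
    using that unfolding A_def
    by (induction rule: span_induct_alt) (auto simp: p_simps u_pw)
  have A_comm: "p v (p y z) = p y (p v z)" if "v \<in> A" for v z
    using that unfolding A_def
    by (induction rule: span_induct_alt) (use pw_comm in \<open>auto simp: p_simps\<close>)
  have "p y z \<in> A" if "z \<in> A" for z
    using that unfolding A_def
  proof (induction rule: span_induct_alt)
    case (step t x z)
    then obtain n where "x = pw n" by blast
    then have "p y x \<in> span (range pw)" by (metis pw_Suc rangeI span_base)
    with step show ?case by (simp add: p_simps span_add span_scale)
  qed (simp add: span_zero)
  then have yA: "p y ` A \<subseteq> A" by blast
  have "u \<in> A" unfolding A_def by (metis pw_0 rangeI span_base)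
  then obtain v \<mu> where v: "v \<in> A" "v \<noteq> 0" "p y v = \<mu> *\<^sub>R v"
    using symmetric_eigenvector[OF linear_p inner_assoc A yA _ u(2)] by blast
  have "\<exists>\<nu>. p v z = \<nu> *\<^sub>R v" if "z \<in> A" for z
    using that unfolding A_def
  proof (induction rule: span_induct_alt)
    case (step t x z)
    have "\<exists>\<nu>. p v (pw n) = \<nu> *\<^sub>R v" for n
    proof (induction n)
      case 0
      then show ?case using uA[OF v(1)] by (metis commute pw_0 scaleR_one)
    next
      case (Suc n)
      then show ?case
        using A_comm[OF v(1)] v(3) by (auto simp: pw_Suc p_simps)
    qed
    with step obtain \<nu> \<nu>' where "p v x = \<nu> *\<^sub>R v" "p v z = \<nu>' *\<^sub>R v" by blast
    then have "p v (t *\<^sub>R x + z) = (t * \<nu> + \<nu>') *\<^sub>R v"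
      by (simp add: p_simps algebra_simps)
    then show ?case ..
  qed (auto intro: exI[of _ 0])
  from this[OF v(1)] obtain \<nu> where \<nu>: "p v v = \<nu> *\<^sub>R v" by blast
  \<comment> \<open>Squares of nonzero elements are nonzero, so \<open>v\<close> can be rescaled to
    an idempotent.\<close>
  then have "\<nu> \<noteq> 0" using v(2) p_self_eq_0_iff[of v] by force
  define d where "d = (1 / \<nu>) *\<^sub>R v"
  show thesis
  proof
    show "idempotent p d"
      using \<open>\<nu> \<noteq> 0\<close> by (simp add: d_def idempotent_def p_simps \<nu>)
    show "d \<noteq> 0"
      using \<open>\<nu> \<noteq> 0\<close> v(2) by (simp add: d_def)
    show "p u d = d"
      using uA[OF v(1)] by (simp add: d_def p_simps)
    show "p y d = \<mu> *\<^sub>R d"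
      using v(3) by (simp add: d_def p_simps)
  qed
qed

text \<open>The idempotent \<open>d\<close> below \<open>c\<close> given by
  \<open>idempotent_eigenvector\<close> must be \<open>c\<close> itself, since
  \<open>c = d + (c - d)\<close> would otherwise split \<open>c\<close>. So \<open>c\<close> is an
  eigenvector of \<open>p y\<close>, and \<open>p y c = y\<close>.\<close>

lemma primitive_idempotent_eigenspace:
  assumes c: "primitive_idempotent p c" and y: "p c y = y"
  obtains \<mu> where "y = \<mu> *\<^sub>R c"
proof -
  have ic: "idempotent p c" "c \<noteq> 0" using c by (auto simp: primitive_idempotent_def)
  obtain d \<mu> where d: "idempotent p d" "d \<noteq> 0" "p c d = d" "p y d = \<mu> *\<^sub>R d"
    using idempotent_eigenvector[OF ic y] by blast
  have "c = d + (c - d)" by simp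
  then have "c - d = 0"
    using c d idempotent_diff[OF ic(1) d(1,3)] unfolding primitive_idempotent_def by metis
  then show thesis
    using that d y by (metis commute eq_iff_diff_eq_0)
qed

lemma primitive_idempotents_inner:
  assumes c: "primitive_idempotent p c" and d: "idempotent p d"
  shows "(c \<bullet> d)\<^sup>2 = (c \<bullet> c) * (2 * (p c d \<bullet> p c d) - c \<bullet> d)"
proof -
  have ic: "idempotent p c" using c by (auto simp: primitive_idempotent_def)
  \<comment> \<open>The polynomial 2 t^2 - t takes the values 0, 0, 1 at 0, 1/2, 1. Hence
    \<open>q\<close> is the component of \<open>d\<close> in the 1-eigenspace of \<open>p c\<close>,
    a multiple of \<open>c\<close>; pairing it with \<open>c\<close> and with \<open>d\<close> gives
    the claim.\<close>
  define q where "q = 2 *\<^sub>R p c (p c d) - p c d"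
  have "p c q = q"
    using idempotent_cubic[OF ic, of d] unfolding q_def
    by (simp add: p_simps scaleR_3 scaleR_2 algebra_simps)
  then obtain t where t: "q = t *\<^sub>R c"
    using primitive_idempotent_eigenspace[OF c] by blast
  have cc: "p c x \<bullet> c = x \<bullet> c" for x
    using ic by (simp add: inner_assoc idempotent_def)
  have "q \<bullet> c = d \<bullet> c" by (simp add: q_def inner_simps cc)
  then have 1: "t * (c \<bullet> c) = c \<bullet> d" by (simp add: t inner_commute)
  have "q \<bullet> d = 2 * (p c d \<bullet> p c d) - c \<bullet> d"
    using inner_idempotents[OF d, of c]
    by (simp add: q_def inner_simps inner_assoc[of c "p c d" d])
  then have "t * (c \<bullet> d) = 2 * (p c d \<bullet> p c d) - c \<bullet> d" by (simp add: t)
  with 1 show ?thesis by (metis mult.commute mult.left_commute power2_eq_square)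
qed

text \<open>The second factor on the right-hand side of the previous identity is symmetric in \<open>c\<close> and \<open>d\<close>.\<close>

lemma primitive_idempotents_norm_eq:
  assumes c: "primitive_idempotent p c" and d: "primitive_idempotent p d" and "c \<bullet> d \<noteq> 0"
  shows "c \<bullet> c = d \<bullet> d"
proof -
  define s where "s = 2 * (p c d \<bullet> p c d) - c \<bullet> d"
  have "(c \<bullet> d)\<^sup>2 = (c \<bullet> c) * s" "(c \<bullet> d)\<^sup>2 = (d \<bullet> d) * s"
    using primitive_idempotents_inner[OF c, of d] primitive_idempotents_inner[OF d, of c] c d
    by (simp_all add: s_def primitive_idempotent_def commute[of d c] inner_commute)
  then show ?thesis using assms(3) by auto
qed

section \<open>The spectral decomposition\<close>

text \<open>Primitivity and the sum \<open>e\<close> are not built in; both follow from maximal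
  cardinality.\<close>

definition eigen_system :: "'a \<Rightarrow> 'a set \<Rightarrow> bool" where
  "eigen_system x E \<longleftrightarrow> pairwise orthogonal E \<and>
     (\<forall>d\<in>E. idempotent p d \<and> d \<noteq> 0 \<and> (\<exists>t. p x d = t *\<^sub>R d))"

section \<open>Eigen systems of maximal cardinality\<close>

lemma eigen_system_finite:
  assumes "eigen_system x E"
  shows "finite E" "card E \<le> DIM('a)"
proof -
  have "independent E"
    using assms by (intro pairwise_orthogonal_independent) (auto simp: eigen_system_def)
  then show "finite E" "card E \<le> DIM('a)"
    using independent_bound_general independent_imp_finite dim_le_card by (auto simp: independent_bound)
qed

text \<open>Otherwise the complement \<open>u\<close> is a nonzero idempotent, and
  \<open>idempotent_eigenvector\<close>, applied to the part \<open>p u x\<close> of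
  \<open>x\<close>, supplies one more member.\<close>

lemma maximal_eigen_system:
  assumes "eigen_system x E" and max: "\<And>E'. eigen_system x E' \<Longrightarrow> card E' \<le> card E"
  shows "\<Sum>E = e"
proof (rule ccontr)
  assume ne: "\<Sum>E \<noteq> e"
  define u where "u = e - \<Sum>E"
  have fin: "finite E" using eigen_system_finite assms by blast
  have E: "idempotent p d" "d \<noteq> 0" "\<exists>t. p x d = t *\<^sub>R d" if "d \<in> E" for d
    using that assms by (auto simp: eigen_system_def)
  have orth: "p d d' = (if d = d' then d else 0)" if "d \<in> E" "d' \<in> E" for d d'
  proof (cases "d = d'")
    case False
    then have "d \<bullet> d' = 0"
      using that assms(1) by (simp add: eigen_system_def pairwise_def orthogonal_def)
    then show ?thesis
      using False orthogonal_idempotents E(1) that by simp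
  qed (use E(1) that in \<open>simp add: idempotent_def\<close>)
  obtain t where t: "\<And>d. d \<in> E \<Longrightarrow> p x d = t d *\<^sub>R d" using E(3) by metis
  have du: "p d u = 0" if "d \<in> E" for d
    using that fin orth by (simp add: u_def p_simps p_sum_right)
  then have "(\<Sum>d\<in>E. p u d) = 0" by (simp add: commute[of u])
  then have "p u u = u"
    unfolding u_def by (simp add: p_simps p_sum_right unit)
  then have u: "idempotent p u" "u \<noteq> 0" using ne by (auto simp: u_def idempotent_def)
  define y where "y = p u x"
  have y: "y = x - (\<Sum>d\<in>E. t d *\<^sub>R d)"
    unfolding y_def commute[of u x] by (simp add: u_def p_simps p_sum_right t)
  have "p u y = y"
    unfolding y by (simp add: p_simps p_sum_right commute[of u] du) (simp add: y y_def[symmetric] commute[of x u])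
  then obtain c \<mu> where c: "idempotent p c" "c \<noteq> 0" "p u c = c" "p y c = \<mu> *\<^sub>R c"
    using idempotent_eigenvector[OF u] by blast
  have dc: "d \<bullet> c = 0" if "d \<in> E" for d
    using du[OF that] c(3) inner_assoc[of u d c] by (simp add: commute[of u d])
  then have pdc: "p c d = 0" if "d \<in> E" for d
    using that orthogonal_idempotents[of d c] E c by (metis commute)
  have "x = y + (\<Sum>d\<in>E. t d *\<^sub>R d)" by (simp add: y)
  then have "p c x = \<mu> *\<^sub>R c"
    using c(4) by (simp add: p_simps p_sum_right pdc commute[of c y])
  then have "eigen_system x (insert c E)"
    using assms(1) c dc
    by (auto simp: eigen_system_def pairwise_insert orthogonal_def inner_commute commute[of x c])
  moreover have "c \<notin> E" using dc[of c] c(2) by fastforce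
  ultimately show False using max[of "insert c E"] fin by simp
qed

text \<open>If \<open>c = a + b\<close> were a splitting, replacing \<open>c\<close> by
  \<open>a\<close> and \<open>b\<close> would enlarge the system.\<close>

lemma maximal_eigen_system_primitive:
  assumes "eigen_system x E" and max: "\<And>E'. eigen_system x E' \<Longrightarrow> card E' \<le> card E"
    and "c \<in> E"
  shows "primitive_idempotent p c"
proof (rule ccontr)
  assume "\<not> primitive_idempotent p c"
  moreover have fin: "finite E" using eigen_system_finite assms by blast
  have E: "idempotent p d" "d \<noteq> 0" "\<exists>t. p x d = t *\<^sub>R d" if "d \<in> E" for d
    using that assms by (auto simp: eigen_system_def)
  ultimately obtain a b where ab: "idempotent p a" "a \<noteq> 0" "idempotent p b" "b \<noteq> 0" "c = a + b"
    using assms(3) unfolding primitive_idempotent_def by metis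
  obtain t where t: "\<And>d. d \<in> E \<Longrightarrow> p x d = t d *\<^sub>R d" using E(3) by metis
  have x: "x = (\<Sum>d\<in>E. t d *\<^sub>R d)"
    using maximal_eigen_system[OF assms(1,2)] t p_sum_right[of x "\<lambda>d. d" E] by simp
  have pab: "p a b = 0" using idempotent_summands ab E assms(3) by metis
  have ab_orth: "a \<bullet> b = 0" using orthogonal_idempotents pab ab by blast
  \<comment> \<open>Both inner products are nonnegative and they add up to
    \<open>d \<bullet> c = 0\<close>.\<close>
  have d_orth: "d \<bullet> a = 0 \<and> d \<bullet> b = 0" if "d \<in> E - {c}" for d
  proof -
    have "d \<bullet> c = 0"
      using that assms by (auto simp: eigen_system_def pairwise_def orthogonal_def)
    then have "d \<bullet> a + d \<bullet> b = 0" using ab by (simp add: inner_simps)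
    moreover have "d \<bullet> a \<ge> 0" "d \<bullet> b \<ge> 0"
      using inner_idempotents_nonneg ab E that by auto
    ultimately show ?thesis by auto
  qed
  \<comment> \<open>Below \<open>c\<close>, multiplication by \<open>x\<close> is the scalar
    \<open>t c\<close>, since the other terms of the expansion of \<open>x\<close> annihilate
    \<open>z\<close>.\<close>
  have eig: "p x z = t c *\<^sub>R z"
    if "idempotent p z" "p z c = z" "\<And>d. d \<in> E - {c} \<Longrightarrow> d \<bullet> z = 0" for z
  proof -
    have "p z d = 0" if "d \<in> E - {c}" for d
      using that orthogonal_idempotents[of d z] E \<open>idempotent p z\<close> \<open>d \<in> E - {c} \<Longrightarrow> d \<bullet> z = 0\<close>
      by (metis DiffD1 commute)
    then have "p z x = t c *\<^sub>R z"
      using that(2) by (subst x) (simp add: p_simps p_sum_right sum.remove[OF fin assms(3)])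
    then show ?thesis by (simp add: commute)
  qed
  have "p a c = a" "p b c = b"
    using ab pab by (auto simp: p_simps idempotent_def commute[of b a])
  with eig ab d_orth have eig': "p x a = t c *\<^sub>R a" "p x b = t c *\<^sub>R b" by blast+
  have "eigen_system x (insert a (insert b (E - {c})))"
    using assms(1) ab ab_orth d_orth eig'
    by (auto simp: eigen_system_def pairwise_insert orthogonal_def inner_commute pairwise_def)
  moreover have "a \<notin> insert b (E - {c})" "b \<notin> E - {c}"
    using ab(2,4) ab_orth d_orth[of a] d_orth[of b] by auto
  then have "card (insert a (insert b (E - {c}))) = Suc (card E)"
    using fin assms(3) by (simp add: card.remove[OF fin assms(3)] del: card_Diff_insert)
  ultimately show False using max by force
qed

lemma spectral_decomposition_exists:
  "\<exists>l es. sorted_wrt (\<ge>) l \<and> jordan_frame p e es \<and> length es = length l \<and>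
     x = (\<Sum>i<length es. (l ! i) *\<^sub>R (es ! i))"
proof -
  have "eigen_system x {}" by (simp add: eigen_system_def)
  moreover have "\<forall>E. eigen_system x E \<longrightarrow> card E < Suc DIM('a)"
    using eigen_system_finite by (auto simp: less_Suc_eq_le)
  ultimately obtain E where E: "eigen_system x E"
    and max: "\<And>E'. eigen_system x E' \<Longrightarrow> card E' \<le> card E"
    using ex_has_greatest_nat[of "eigen_system x" "{}" card] by blast
  have fin: "finite E" using eigen_system_finite E by blast
  obtain t where t: "\<And>d. d \<in> E \<Longrightarrow> p x d = t d *\<^sub>R d"
    using E unfolding eigen_system_def by metis
  obtain xs where xs: "set xs = E" "distinct xs" using finite_distinct_list fin by blast
  define es where "es = rev (sort_key t xs)"
  define l where "l = map t es"
  have es: "set es = E" "distinct es" using xs by (auto simp: es_def)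
  have sum_es: "sum_list (map f es) = (\<Sum>d\<in>E. f d)" for f :: "'a \<Rightarrow> 'a"
    using es by (simp add: sum_list_distinct_conv_sum_set)
  have "sorted_wrt (\<ge>) l"
    by (simp add: l_def es_def sorted_wrt_rev flip: rev_map)
  moreover have "jordan_frame p e es"
    unfolding jordan_frame_def
  proof (intro conjI ballI allI impI)
    show "primitive_idempotent p c" if "c \<in> set es" for c
      using maximal_eigen_system_primitive[OF E max] that es by blast
    show "sum_list es = e"
      using sum_es[of id] maximal_eigen_system[OF E max] by simp
    fix i j assume ij: "i < length es" "j < length es" "i \<noteq> j"
    then have "es ! i \<noteq> es ! j" "es ! i \<in> E" "es ! j \<in> E"
      using es nth_eq_iff_index_eq by auto
    then show "p (es ! i) (es ! j) = 0"
      using E orthogonal_idempotents[of "es ! i" "es ! j"]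
      by (auto simp: eigen_system_def pairwise_def orthogonal_def)
  qed
  moreover have "x = (\<Sum>i<length es. (l ! i) *\<^sub>R (es ! i))"
  proof -
    have "x = (\<Sum>d\<in>E. t d *\<^sub>R d)"
      using maximal_eigen_system[OF E max] t p_sum_right[of x "\<lambda>d. d" E] by simp
    also have "\<dots> = sum_list (map (\<lambda>d. t d *\<^sub>R d) es)" by (simp add: sum_es)
    also have "\<dots> = (\<Sum>i<length es. (l ! i) *\<^sub>R (es ! i))"
      by (simp add: sum_list_sum_nth l_def atLeast0LessThan)
    finally show ?thesis .
  qed
  moreover have "length es = length l" by (simp add: l_def)
  ultimately show ?thesis by blast
qed

section \<open>Uniqueness of the eigenvalues\<close>

lemma jordan_frame_orthogonal:
  assumes "jordan_frame p e es" "i < length es" "j < length es" "i \<noteq> j"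
  shows "es ! i \<bullet> es ! j = 0"
  using assms orthogonal_idempotents[of "es ! i" "es ! j"]
  by (auto simp: jordan_frame_def primitive_idempotent_def)

lemma jordan_frame_sum:
  assumes "jordan_frame p e es"
  shows "(\<Sum>i<length es. es ! i) = e"
  using assms by (simp add: jordan_frame_def sum_list_sum_nth atLeast0LessThan)

text \<open>Evaluates the row and column sums of the matrix of inner products of two frames, as each
  frame sums to \<open>e\<close>.\<close>

lemma jordan_frame_inner_unit:
  assumes "jordan_frame p e es" "i < length es"
  shows "es ! i \<bullet> e = es ! i \<bullet> es ! i"
proof -
  have "es ! i \<bullet> e = (\<Sum>j<length es. es ! i \<bullet> es ! j)"
    by (simp add: jordan_frame_sum[OF assms(1)] flip: inner_sum_right)
  also have "\<dots> = (\<Sum>j<length es. if i = j then es ! i \<bullet> es ! i else 0)"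
    using jordan_frame_orthogonal[OF assms] by (intro sum.cong) auto
  finally show ?thesis using assms(2) by simp
qed

text \<open>The matrix \<open>a i j / |es ! i|\<^sup>2\<close> is doubly stochastic, because \<open>|es ! i| = |fs ! j|\<close> whenever
  \<open>a i j \<noteq> 0\<close>; moreover \<open>a i j \<noteq> 0\<close> forces \<open>l ! i = m ! j\<close>, since
  \<open>(\<Sum>i j. a i j * (l ! i - m ! j)\<^sup>2) = |x|\<^sup>2 - 2 |x|\<^sup>2 + |x|\<^sup>2\<close>.\<close>

lemma spectral_decomposition_mset:
  assumes es: "jordan_frame p e es" "length es = length l"
      "x = (\<Sum>i<length es. (l ! i) *\<^sub>R (es ! i))"
    and fs: "jordan_frame p e fs" "length fs = length m"
      "x = (\<Sum>j<length fs. (m ! j) *\<^sub>R (fs ! j))"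
  shows "mset l = mset m"
proof (rule multiset_eqI)
  fix s
  define a where "a i j = es ! i \<bullet> fs ! j" for i j
  define I where "I = {..<length es}"
  define J where "J = {..<length fs}"
  have fin: "finite I" "finite J" by (auto simp: I_def J_def)
  have prim: "i \<in> I \<Longrightarrow> primitive_idempotent p (es ! i)" "j \<in> J \<Longrightarrow> primitive_idempotent p (fs ! j)" for i j
    using es(1) fs(1) by (auto simp: jordan_frame_def I_def J_def)
  have idem: "i \<in> I \<Longrightarrow> idempotent p (es ! i) \<and> es ! i \<noteq> 0"
    "j \<in> J \<Longrightarrow> idempotent p (fs ! j) \<and> fs ! j \<noteq> 0" for i j
    using prim by (auto simp: primitive_idempotent_def)
  have a_nonneg: "a i j \<ge> 0" if "i \<in> I" "j \<in> J" for i j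
    using that idem inner_idempotents_nonneg by (auto simp: a_def)
  have row: "(\<Sum>j\<in>J. a i j) = es ! i \<bullet> es ! i" if "i \<in> I" for i
    using jordan_frame_inner_unit[OF es(1), of i] jordan_frame_sum[OF fs(1)] that
    by (simp add: a_def I_def J_def flip: inner_sum_right)
  have col: "(\<Sum>i\<in>I. a i j) = fs ! j \<bullet> fs ! j" if "j \<in> J" for j
    using jordan_frame_inner_unit[OF fs(1), of j] jordan_frame_sum[OF es(1)] that
    by (simp add: a_def I_def J_def inner_commute[of e] flip: inner_sum_left)
  have x_I: "x = (\<Sum>i\<in>I. l ! i *\<^sub>R es ! i)" and x_J: "x = (\<Sum>j\<in>J. m ! j *\<^sub>R fs ! j)"
    using es(3) fs(3) unfolding I_def J_def by blast+
  have x_es: "x \<bullet> es ! i = l ! i * (es ! i \<bullet> es ! i)" if "i \<in> I" for i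
  proof -
    have "x \<bullet> es ! i = (\<Sum>k\<in>I. l ! k * (es ! k \<bullet> es ! i))"
      by (subst x_I) (simp add: inner_sum_left)
    also have "\<dots> = (\<Sum>k\<in>I. if k = i then l ! i * (es ! i \<bullet> es ! i) else 0)"
      using that jordan_frame_orthogonal[OF es(1), of _ i] by (intro sum.cong) (auto simp: I_def)
    finally show ?thesis using that fin by simp
  qed
  have x_fs: "x \<bullet> fs ! j = m ! j * (fs ! j \<bullet> fs ! j)" if "j \<in> J" for j
  proof -
    have "x \<bullet> fs ! j = (\<Sum>k\<in>J. m ! k * (fs ! k \<bullet> fs ! j))"
      by (subst x_J) (simp add: inner_sum_left)
    also have "\<dots> = (\<Sum>k\<in>J. if k = j then m ! j * (fs ! j \<bullet> fs ! j) else 0)"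
      using that jordan_frame_orthogonal[OF fs(1), of _ j] by (intro sum.cong) (auto simp: J_def)
    finally show ?thesis using that fin by simp
  qed
  have "x \<bullet> x = x \<bullet> (\<Sum>i\<in>I. l ! i *\<^sub>R es ! i)" by (rule arg_cong[OF x_I])
  then have xx_l: "x \<bullet> x = (\<Sum>i\<in>I. (l ! i)\<^sup>2 * (es ! i \<bullet> es ! i))"
    by (simp add: inner_sum_right x_es power2_eq_square mult.assoc)
  have "x \<bullet> x = x \<bullet> (\<Sum>j\<in>J. m ! j *\<^sub>R fs ! j)" by (rule arg_cong[OF x_J])
  then have xx_m: "x \<bullet> x = (\<Sum>j\<in>J. (m ! j)\<^sup>2 * (fs ! j \<bullet> fs ! j))"
    by (simp add: inner_sum_right x_fs power2_eq_square mult.assoc)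
  have "x \<bullet> x = (\<Sum>i\<in>I. l ! i *\<^sub>R es ! i) \<bullet> (\<Sum>j\<in>J. m ! j *\<^sub>R fs ! j)"
    by (rule arg_cong2[OF x_I x_J])
  also have "\<dots> = (\<Sum>j\<in>J. \<Sum>i\<in>I. a i j * (l ! i) * (m ! j))"
    by (simp add: inner_sum_right inner_sum_left a_def sum_distrib_left mult_ac)
  also have "\<dots> = (\<Sum>i\<in>I. \<Sum>j\<in>J. a i j * (l ! i) * (m ! j))"
    by (rule sum.swap)
  finally have xx_lm: "x \<bullet> x = (\<Sum>i\<in>I. \<Sum>j\<in>J. a i j * (l ! i) * (m ! j))" .
  have "a i j * (l ! i - m ! j)\<^sup>2
      = (l ! i)\<^sup>2 * a i j + (m ! j)\<^sup>2 * a i j - 2 * (a i j * (l ! i) * (m ! j))" for i j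
    by (simp add: power2_eq_square algebra_simps)
  then have "(\<Sum>i\<in>I. \<Sum>j\<in>J. a i j * (l ! i - m ! j)\<^sup>2)
      = (\<Sum>i\<in>I. \<Sum>j\<in>J. (l ! i)\<^sup>2 * a i j) + (\<Sum>i\<in>I. \<Sum>j\<in>J. (m ! j)\<^sup>2 * a i j)
        - 2 * (\<Sum>i\<in>I. \<Sum>j\<in>J. a i j * (l ! i) * (m ! j))"
    by (simp only: sum.distrib sum_subtractf sum_distrib_left)
  also have "(\<Sum>i\<in>I. \<Sum>j\<in>J. (l ! i)\<^sup>2 * a i j) = x \<bullet> x"
    by (simp add: xx_l row flip: sum_distrib_left)
  also have "(\<Sum>i\<in>I. \<Sum>j\<in>J. (m ! j)\<^sup>2 * a i j) = x \<bullet> x"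
    by (subst sum.swap) (simp add: xx_m col flip: sum_distrib_left)
  finally have "(\<Sum>i\<in>I. \<Sum>j\<in>J. a i j * (l ! i - m ! j)\<^sup>2) = 0" by (simp flip: xx_lm)
  moreover have nonneg: "a i j * (l ! i - m ! j)\<^sup>2 \<ge> 0" if "i \<in> I" "j \<in> J" for i j
    using a_nonneg[OF that] by simp
  ultimately have "(\<Sum>j\<in>J. a i j * (l ! i - m ! j)\<^sup>2) = 0" if "i \<in> I" for i
    using that fin by (simp add: sum_nonneg_eq_0_iff sum_nonneg)
  then have eq: "a i j * (l ! i - m ! j)\<^sup>2 = 0" if "i \<in> I" "j \<in> J" for i j
    using that fin nonneg by (metis (no_types, lifting) sum_nonneg_eq_0_iff)
  \<comment> \<open>Dividing by rows or by columns gives the same matrix, so its rows and columns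
    all sum to 1.\<close>
  define b where "b i j = a i j / (es ! i \<bullet> es ! i)" for i j
  have b: "b i j = a i j / (fs ! j \<bullet> fs ! j)" if "i \<in> I" "j \<in> J" for i j
    using primitive_idempotents_norm_eq[OF prim(1)[OF that(1)] prim(2)[OF that(2)]]
    by (cases "a i j = 0") (auto simp: a_def b_def)
  have b_eq_0: "b i j = 0" if "i \<in> I" "j \<in> J" "l ! i \<noteq> m ! j" for i j
    using eq[OF that(1,2)] that(3) by (auto simp: b_def)
  define Is where "Is = {i \<in> I. l ! i = s}"
  define Js where "Js = {j \<in> J. m ! j = s}"
  \<comment> \<open>Double counting: \<open>b\<close> vanishes between indices with different
    eigenvalues, so its sum over \<open>Is\<close> and \<open>Js\<close> counts \<open>Is\<close> by
    rows and \<open>Js\<close> by columns.\<close>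
  have "real (card Is) = (\<Sum>i\<in>Is. \<Sum>j\<in>J. b i j)"
    using row idem by (simp add: Is_def b_def flip: sum_divide_distrib)
  also have "\<dots> = (\<Sum>i\<in>Is. \<Sum>j\<in>Js. b i j)"
    using fin by (intro sum.cong[OF refl] sum.mono_neutral_right) (auto simp: Is_def Js_def intro!: b_eq_0)
  also have "\<dots> = (\<Sum>i\<in>I. \<Sum>j\<in>Js. b i j)"
    using fin by (intro sum.mono_neutral_left) (auto simp: Is_def Js_def intro!: sum.neutral b_eq_0)
  also have "\<dots> = (\<Sum>j\<in>Js. \<Sum>i\<in>I. a i j / (fs ! j \<bullet> fs ! j))"
    by (subst sum.swap) (simp add: Js_def b)
  also have "\<dots> = real (card Js)"
    using col idem by (simp add: Js_def flip: sum_divide_distrib)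
  finally have "card Is = card Js" by simp
  then show "count (mset l) s = count (mset m) s"
    by (simp add: count_mset count_list_eq_length_filter length_filter_conv_card Is_def Js_def
        I_def J_def es(2) fs(2) eq_commute[of s])
qed

text \<open>In every frame \<open>e\<close> has all coefficients 1; uniqueness of the multiset of
  coefficients of \<open>e\<close> then compares the lengths.\<close>

lemma jordan_frame_length:
  assumes "jordan_frame p e es"
  shows "length es = jordan_rank p e"
  unfolding jordan_rank_def
proof (rule the_equality[symmetric])
  fix k assume "\<exists>fs. jordan_frame p e fs \<and> length fs = k"
  then obtain fs where fs: "jordan_frame p e fs" "length fs = k" by blast
  have unit_sum: "e = (\<Sum>i<length gs. replicate (length gs) (1::real) ! i *\<^sub>R (gs ! i))"
    if "jordan_frame p e gs" for gs
    using jordan_frame_sum[OF that] by simp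
  have "mset (replicate (length fs) (1::real)) = mset (replicate (length es) 1)"
    by (rule spectral_decomposition_mset[OF fs(1) _ unit_sum[OF fs(1)] assms _ unit_sum[OF assms]]) simp_all
  then show "k = length es"
    using fs by (metis length_replicate mset_eq_length)
qed (use assms in blast)

text \<open>Justifies the definite description in \<open>eigenvalues\<close>: a nonincreasing list
  is determined by its multiset.\<close>

lemma eigenvalues_decomposition:
  shows "sorted_wrt (\<ge>) (eigenvalues p e x)" "length (eigenvalues p e x) = jordan_rank p e"
proof -
  let ?P = "\<lambda>l. sorted_wrt (\<ge>) l \<and>
     (\<exists>es. jordan_frame p e es \<and> length es = length l \<and>
           x = (\<Sum>i<length es. (l ! i) *\<^sub>R (es ! i)))"
  have "\<exists>!l. ?P l"
  proof (rule ex_ex1I)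
    show "\<exists>l. ?P l" using spectral_decomposition_exists[of x] by blast
    fix l m assume l: "?P l" and m: "?P m"
    obtain es fs where "jordan_frame p e es" "length es = length l"
        "x = (\<Sum>i<length es. (l ! i) *\<^sub>R (es ! i))"
      and "jordan_frame p e fs" "length fs = length m"
        "x = (\<Sum>i<length fs. (m ! i) *\<^sub>R (fs ! i))"
      using l m by metis
    then have "mset l = mset m" by (rule spectral_decomposition_mset)
    then have "mset (rev l) = mset (rev m)" by simp
    moreover have "sorted (rev l)" "sorted (rev m)"
      using l m by (simp_all add: sorted_wrt_rev)
    ultimately show "l = m" by (metis properties_for_sort rev_swap)
  qed
  then have "?P (eigenvalues p e x)"
    unfolding eigenvalues_def by (rule theI')
  then show "sorted_wrt (\<ge>) (eigenvalues p e x)" "length (eigenvalues p e x) = jordan_rank p e"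
    using jordan_frame_length by auto
qed

end

section \<open>Schur convexity\<close>

text \<open>Summation by parts as an induction: the weighted sum through \<open>j\<close> is at
  least \<open>w j\<close> times the partial sum, and lowering the weight on a nonnegative partial
  sum preserves this.\<close>

lemma sum_mult_antimono_nonneg:
  fixes w \<delta> :: "nat \<Rightarrow> real"
  assumes "\<And>i j. i \<le> j \<Longrightarrow> j < k \<Longrightarrow> w j \<le> w i" "\<And>i. i < k \<Longrightarrow> w i \<ge> 0"
    and "\<And>j. j \<le> k \<Longrightarrow> (\<Sum>i<j. \<delta> i) \<ge> 0"
  shows "(\<Sum>i<k. w i * \<delta> i) \<ge> 0"
proof (cases k)
  case (Suc m)
  have "(\<Sum>i<Suc j. w i * \<delta> i) \<ge> w j * (\<Sum>i<Suc j. \<delta> i)" if "j < k" for j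
    using that
  proof (induction j)
    case (Suc j)
    have "w (Suc j) * (\<Sum>i<Suc j. \<delta> i) \<le> w j * (\<Sum>i<Suc j. \<delta> i)"
      using Suc.prems assms(1)[of j "Suc j"] assms(3)[of "Suc j"] by (intro mult_right_mono) auto
    then show ?case using Suc by (simp add: algebra_simps)
  qed simp
  from this[of m] show ?thesis
    using Suc mult_nonneg_nonneg[OF assms(2)[of m] assms(3)[of k]] by simp
qed simp

text \<open>The remainder at \<open>d\<close> of the tangent to 1 / s^2 at \<open>b\<close>,
  factored so that its sign is visible.\<close>

lemma inverse_square_tangent:
  fixes b d :: real
  assumes "b > 0" "d > 0"
  shows "1 / d\<^sup>2 - 1 / b\<^sup>2 - 2 / b ^ 3 * (b - d) = (b - d)\<^sup>2 * (b + 2 * d) / (b ^ 3 * d\<^sup>2)"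
  using assms by (simp add: divide_simps) (simp add: power2_eq_square power3_eq_cube algebra_simps)

text \<open>Although \<open>t\<^sup>2 / s\<^sup>2\<close> is not jointly convex, it is convex in each variable. The numerators
  \<open>a\<close> are therefore changed to \<open>c\<close> before the denominators \<open>b\<close> are changed to \<open>d\<close>.\<close>

lemma sum_square_quotients_less:
  fixes a b c d :: "nat \<Rightarrow> real"
  assumes pos: "\<And>i. i < k \<Longrightarrow> a i > 0 \<and> b i > 0 \<and> c i > 0 \<and> d i > 0"
    and mono: "\<And>i j. i \<le> j \<Longrightarrow> j < k \<Longrightarrow> a j \<le> a i \<and> b i \<le> b j \<and> c j \<le> c i"
    and ac: "\<And>j. j \<le> k \<Longrightarrow> (\<Sum>i<j. a i) \<le> (\<Sum>i<j. c i)"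
    and bd: "\<And>j. j \<le> k \<Longrightarrow> (\<Sum>i<j. d i) \<le> (\<Sum>i<j. b i)"
    and ne: "\<exists>i<k. a i \<noteq> c i \<or> b i \<noteq> d i"
  shows "(\<Sum>i<k. (a i / b i)\<^sup>2) < (\<Sum>i<k. (c i / d i)\<^sup>2)"
proof -
  \<comment> \<open>The two quadratic remainders: of t^2 / \<open>(b i)\<^sup>2\<close> from
    \<open>a i\<close> to \<open>c i\<close>, then of \<open>(c i)\<^sup>2\<close> / s^2 from
    \<open>b i\<close> to \<open>d i\<close>.\<close>
  define r where "r i = (c i - a i)\<^sup>2 / (b i)\<^sup>2
    + (c i)\<^sup>2 * ((b i - d i)\<^sup>2 * (b i + 2 * d i) / (b i ^ 3 * (d i)\<^sup>2))" for i
  have eq: "(c i / d i)\<^sup>2 - (a i / b i)\<^sup>2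
      = 2 * a i / (b i)\<^sup>2 * (c i - a i) + 2 * (c i)\<^sup>2 / b i ^ 3 * (b i - d i) + r i"
    if "i < k" for i
  proof -
    have "(c i / d i)\<^sup>2 - (c i / b i)\<^sup>2
        = (c i)\<^sup>2 * (2 / b i ^ 3 * (b i - d i) + (b i - d i)\<^sup>2 * (b i + 2 * d i) / (b i ^ 3 * (d i)\<^sup>2))"
      using inverse_square_tangent[of "b i" "d i"] pos[OF that]
      by (simp add: power_divide flip: inverse_square_tangent) (simp add: algebra_simps)
    moreover have "(c i / b i)\<^sup>2 - (a i / b i)\<^sup>2
        = 2 * a i / (b i)\<^sup>2 * (c i - a i) + (c i - a i)\<^sup>2 / (b i)\<^sup>2"
      using pos[OF that] by (simp add: divide_simps) (simp add: power2_eq_square algebra_simps)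
    ultimately show ?thesis by (simp add: r_def algebra_simps)
  qed
  have "(\<Sum>i<k. 2 * a i / (b i)\<^sup>2 * (c i - a i)) \<ge> 0"
  proof (rule sum_mult_antimono_nonneg)
    fix i j assume "i \<le> j" "j < k"
    then show "2 * a j / (b j)\<^sup>2 \<le> 2 * a i / (b i)\<^sup>2"
      using mono[of i j] pos[of i] pos[of j] by (intro frac_le power_mono) auto
  qed (use pos ac in \<open>auto simp: sum_subtractf less_imp_le\<close>)
  moreover have "(\<Sum>i<k. 2 * (c i)\<^sup>2 / b i ^ 3 * (b i - d i)) \<ge> 0"
  proof (rule sum_mult_antimono_nonneg)
    fix i j assume "i \<le> j" "j < k"
    then show "2 * (c j)\<^sup>2 / b j ^ 3 \<le> 2 * (c i)\<^sup>2 / b i ^ 3"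
      using mono[of i j] pos[of i] pos[of j]
      by (intro frac_le power_mono mult_left_mono zero_less_power) auto
  qed (use pos bd in \<open>auto simp: sum_subtractf less_imp_le\<close>)
  moreover have "(\<Sum>i<k. r i) > 0"
  proof -
    have r: "r i \<ge> 0" "a i \<noteq> c i \<or> b i \<noteq> d i \<Longrightarrow> r i > 0" if "i < k" for i
    proof -
      have p: "b i > 0" "c i > 0" "d i > 0" "b i + 2 * d i > 0"
        using pos[OF that] by auto
      have 1: "(c i - a i)\<^sup>2 / (b i)\<^sup>2 \<ge> 0" by simp
      have 2: "(c i)\<^sup>2 * ((b i - d i)\<^sup>2 * (b i + 2 * d i) / (b i ^ 3 * (d i)\<^sup>2)) \<ge> 0"
        using p by (intro mult_nonneg_nonneg divide_nonneg_pos) auto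
      show "r i \<ge> 0" unfolding r_def using 1 2 by (rule add_nonneg_nonneg)
      assume "a i \<noteq> c i \<or> b i \<noteq> d i"
      then show "r i > 0"
      proof
        assume "a i \<noteq> c i"
        then have "(c i - a i)\<^sup>2 / (b i)\<^sup>2 > 0" using p by simp
        then show ?thesis unfolding r_def using 2 by (rule add_pos_nonneg)
      next
        assume "b i \<noteq> d i"
        then have "(c i)\<^sup>2 * ((b i - d i)\<^sup>2 * (b i + 2 * d i) / (b i ^ 3 * (d i)\<^sup>2)) > 0"
          using p by (intro mult_pos_pos divide_pos_pos) auto
        with 1 show ?thesis unfolding r_def by (rule add_nonneg_pos)
      qed
    qed
    obtain i where "i < k" "a i \<noteq> c i \<or> b i \<noteq> d i" using ne by blast
    with r show ?thesis by (intro sum_pos2[of _ i]) auto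
  qed
  ultimately have "(\<Sum>i<k. (c i / d i)\<^sup>2 - (a i / b i)\<^sup>2) > 0"
    by (simp add: eq sum.distrib)
  then show ?thesis by (simp add: sum_subtractf)
qed

section \<open>Nonincreasing rearrangements and the norm of \<open>phi\<close>\<close>

lemma length_decreasing [simp]: "length (decreasing u) = length u"
  by (simp add: decreasing_def)

lemma set_decreasing [simp]: "set (decreasing u) = set u"
  by (simp add: decreasing_def)

lemma decreasing_nth_mono:
  assumes "i \<le> j" "j < length u"
  shows "decreasing u ! j \<le> decreasing u ! i"
  using assms by (auto simp: decreasing_def rev_nth intro!: sorted_nth_mono)

lemma decreasing_cong_mset: "mset u = mset v \<Longrightarrow> decreasing u = decreasing v"
  unfolding decreasing_def by (metis mset_sort properties_for_sort sorted_sort)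

lemma decreasing_sorted: "sorted_wrt (\<ge>) l \<Longrightarrow> decreasing l = l"
  unfolding decreasing_def by (metis mset_rev properties_for_sort rev_rev_ident sorted_wrt_rev)

lemma phi_norm_eq:
  "phi_norm n u = sqrt (\<Sum>i<n div 2. (decreasing u ! i / decreasing u ! (n - 1 - i))\<^sup>2)"
  by (simp add: phi_norm_def euclidean_norm_def L2_set_def phi_def)

text \<open>Turns majorization, which bounds sums of the largest entries, into the reverse bound for
  sums of the smallest ones.\<close>

lemma sum_last_nth:
  fixes g :: "nat \<Rightarrow> real"
  assumes "j \<le> n"
  shows "(\<Sum>i<j. g (n - 1 - i)) = (\<Sum>i<n. g i) - (\<Sum>i<n - j. g i)"
proof -
  have "(\<Sum>i<j. g (n - 1 - i)) = (\<Sum>i\<in>{n - j..<n}. g i)"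
    using assms by (intro sum.reindex_bij_witness[of _ "\<lambda>i. n - 1 - i" "\<lambda>i. n - 1 - i"]) auto
  also have "\<dots> = (\<Sum>i<n. g i) - (\<Sum>i<n - j. g i)"
    using sum.atLeastLessThan_concat[of 0 "n - j" n g] by (simp add: atLeast0LessThan)
  finally show ?thesis .
qed

text \<open>The numerators are the largest entries and the denominators the smallest ones, in
  increasing order. Majorization with equal totals gives the partial sum conditions of
  \<open>sum_square_quotients_less\<close> for both.\<close>

lemma phi_norm_less:
  assumes u: "u \<in> pos_vectors n" and v: "v \<in> pos_vectors n"
    and maj: "majorized n u v" and ne: "decreasing u \<noteq> decreasing v"
  shows "phi_norm n u < phi_norm n v"
proof -
  define U where "U = decreasing u"
  define V where "V = decreasing v"
  have len: "length U = n" "length V = n" "length u = n" "length v = n"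
    using u v by (auto simp: pos_vectors_def U_def V_def)
  have pos: "U ! i > 0" "V ! i > 0" if "i < n" for i
    using u v that len nth_mem[of i U] nth_mem[of i V]
    by (auto simp: pos_vectors_def U_def V_def)
  have mono: "U ! j \<le> U ! i" "V ! j \<le> V ! i" if "i \<le> j" "j < n" for i j
    using that len decreasing_nth_mono by (auto simp: U_def V_def)
  have le: "(\<Sum>i<j. U ! i) \<le> (\<Sum>i<j. V ! i)" if "j \<le> n" for j
    using maj that by (cases "j = 0") (auto simp: majorized_def U_def V_def)
  have tot: "(\<Sum>i<n. U ! i) = (\<Sum>i<n. V ! i)"
    using maj by (auto simp: majorized_def U_def V_def)
  \<comment> \<open>For odd \<open>n\<close> the middle entry occurs in no quotient. If all other
    entries agreed, the equal totals would make it agree too.\<close>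
  have "\<exists>i<n div 2. U ! i \<noteq> V ! i \<or> U ! (n - 1 - i) \<noteq> V ! (n - 1 - i)"
  proof (rule ccontr)
    assume "\<not> ?thesis"
    then have H: "U ! i = V ! i" "U ! (n - 1 - i) = V ! (n - 1 - i)" if "i < n div 2" for i
      using that by auto
    have off_middle: "U ! i = V ! i" if "i < n" "i \<noteq> n div 2" for i
    proof (cases "i < n div 2")
      case False
      then have "n - 1 - i < n div 2" "n - 1 - (n - 1 - i) = i" using that by linarith+
      then show ?thesis using H(2)[of "n - 1 - i"] by simp
    qed (simp add: H)
    have "U ! i = V ! i" if "i < n" for i
    proof -
      have m: "n div 2 \<in> {..<n}" using that by auto
      have "(\<Sum>i\<in>{..<n} - {n div 2}. U ! i) = (\<Sum>i\<in>{..<n} - {n div 2}. V ! i)"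
        using off_middle by (intro sum.cong) auto
      then have "U ! (n div 2) = V ! (n div 2)"
        using tot by (simp add: sum.remove[OF _ m])
      then show ?thesis using off_middle that by metis
    qed
    then have "U = V" using len by (intro nth_equalityI) auto
    then show False using ne by (simp add: U_def V_def)
  qed
  moreover have "(\<Sum>i<j. V ! (n - 1 - i)) \<le> (\<Sum>i<j. U ! (n - 1 - i))" if "j \<le> n div 2" for j
    using that le[of "n - j"] tot by (simp only: sum_last_nth[of j n]) simp
  ultimately have "(\<Sum>i<n div 2. (U ! i / U ! (n - 1 - i))\<^sup>2) < (\<Sum>i<n div 2. (V ! i / V ! (n - 1 - i))\<^sup>2)"
    using pos mono le by (intro sum_square_quotients_less) auto
  then show ?thesis by (simp add: phi_norm_eq U_def V_def)
qed

lemma phi_norm_strictly_schur_convex: "strictly_schur_convex n (phi_norm n)"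
  unfolding strictly_schur_convex_def
proof (intro ballI impI)
  fix u v assume *: "u \<in> pos_vectors n" "v \<in> pos_vectors n" "majorized n u v"
  have "phi_norm n u = phi_norm n v" if "decreasing u = decreasing v"
    using that by (simp add: phi_norm_eq)
  then show "phi_norm n u \<le> phi_norm n v \<and> (decreasing u \<noteq> decreasing v \<longrightarrow> phi_norm n u < phi_norm n v)"
    using phi_norm_less[OF *] by force
qed

lemma permutation_invariant_phi_norm: "permutation_invariant n (phi_norm n)"
  unfolding permutation_invariant_def
proof (intro ballI allI impI)
  fix u :: "real list" and \<pi> assume "u \<in> pos_vectors n" "\<pi> permutes {..<n}"
  then have "mset (permute_list \<pi> u) = mset u"
    by (intro mset_permute_list) (auto simp: pos_vectors_def)
  then have "decreasing (permute_list \<pi> u) = decreasing u"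
    by (rule decreasing_cong_mset)
  then show "phi_norm n (permute_list \<pi> u) = phi_norm n u"
    by (simp add: phi_norm_eq)
qed

section \<open>The condition number as a spectral function\<close>

theorem proposition7p2:
  fixes p :: "'a::euclidean_space \<Rightarrow> 'a \<Rightarrow> 'a" and e :: 'a and n :: nat
  assumes "euclidean_jordan_algebra p e"
    and "jordan_rank p e = n"
    and "n \<ge> 2"
  shows "spectral_function p e (kappa_norm p e) (phi_norm n) \<and>
         strictly_schur_convex_spectral p e (kappa_norm p e)"
proof -
  interpret euclidean_jordan_algebra p e by fact
  have "eigenvalues p e x \<in> pos_vectors n" if "x \<in> positive_cone p e" for x
  proof -
    let ?l = "eigenvalues p e x"
    have "?l ! i > 0" if "i < n" for i
    proof -
      have "?l ! (n - 1) \<le> ?l ! i"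
        using sorted_wrt_nth_less[OF eigenvalues_decomposition(1)[of x], of i "n - 1"] that
          eigenvalues_decomposition(2)[of x] assms(2)
        by (cases "i = n - 1") auto
      then show ?thesis
        using \<open>x \<in> positive_cone p e\<close> assms(2) by (simp add: positive_cone_def)
    qed
    then show ?thesis
      using eigenvalues_decomposition(2)[of x] assms(2) by (auto simp: pos_vectors_def in_set_conv_nth)
  qed
  \<comment> \<open>The list of eigenvalues is already nonincreasing, hence fixed by
    \<open>decreasing\<close>.\<close>
  moreover have "kappa_norm p e x = phi_norm n (eigenvalues p e x)" for x
    using assms(2) decreasing_sorted[OF eigenvalues_decomposition(1)[of x]]
    by (simp add: kappa_norm_def kappa_def phi_norm_def phi_def Let_def)
  ultimately have "spectral_function p e (kappa_norm p e) (phi_norm n)"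
    using permutation_invariant_phi_norm assms(2) by (simp add: spectral_function_def)
  then show ?thesis
    using phi_norm_strictly_schur_convex assms(2) unfolding strictly_schur_convex_spectral_def by blast
qed

end
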